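(* In the setting of the context, let $v$ be a discrete valuation of $\overline F L$ (normalised so that $v((\overline F L)^* )=\mathbb Z$) with uniformiser $\pi$ and residue field $\kappa_v$, let $D$ be $v$-bounded with shift $s=s_v$, let $r:=\sigma_v(\pi)-s\ge0$, and let $f\in L$ have an elementary integral, written as $f=Dg+\sum_ic_i\,Du_i/u_i$ with $g\in\overline F L$, $c_i\in\overline F$, $u_i\in(\overline F L)^*$. Suppose one of the following holds: (i) $r=0$ and $N_v\cap\mathbb Z_{<0}=\emptyset$; (ii) $r\ge1$, the field of constants of $(\kappa_v,\partial_v)$ is $\overline F$, and $\rho_v^{(r)}:=\overline{\pi^{-s-1-r}D\pi}\in\kappa_v^*$ is not of the form $\partial_v\bar c$ with $\bar c\in\kappa_v$. Then $$v(g)\ge\min\bigl(0,\,v(f)-s\bigr)-r=\min\bigl(-r,\,v(f)-\sigma_v(\pi)\bigr).$$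
   Context: All fields have characteristic $0$; $\overline F$ is an algebraic closure of $F$. $(L,D)$ is a differential field built as follows: (T1) $K_0=F(t_1,\dots,t_j)$ with $DF\subseteq F$, each $t_i$ transcendental over $F(t_1,\dots,t_{i-1})$, $Dt_i\in F(t_1,\dots,t_i)$; (T2) $y^m=q\in F[t_1,\dots,t_j]$, $q$ $m$-th-power-free, $Y^m-q$ irreducible over $\overline F(t_1,\dots,t_j)$; (T3) $t_{j+1},\dots,t_n$ successively transcendental over the field below, $Dt_i\in K_0(y)(t_{j+1},\dots,t_i)$; (T4) $L=K_0(y)(t_{j+1},\dots,t_n)$ has field of constants $F$. $D$ extends uniquely to $\overline F L$ with $D\overline F=0$. $f$ has an elementary integral if $f=Dh$ with $h$ in an elementary extension of $L$; by Liouville's theorem it then has a representation as in the claim. For a discrete valuation $v$ of $\overline F L$ with valuation ring $\mathcal V_v$, bars denote residue classes. The shift of $h\in(\overline F L)^*$ with $Dh\ne0$ is $\sigma_v(h):=v(Dh)-v(h)$; $D$ is $v$-bounded if $\sigma_v$ is bounded below, and then $s_v:=\min_h\sigma_v(h)$. With $s=s_v$, the rule $\partial_v\bar c:=\overline{\pi^{-s}Dc}$ ($c\in\mathcal V_v$) defines a derivation $\partial_v$ of $\kappa_v$ vanishing on $\overline F$, and $\rho_v:=\overline{\pi^{-s-1}D\pi}\in\kappa_v$. The kernel degrees of $v$ are $$N_v:=\{a\in\mathbb Z:\ \partial_v\bar c=-a\rho_v\bar c\ \text{for some }\bar c\in\kappa_v^*\}.$$ *)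

theory Defs
  imports "HOL-Algebra.Generated_Fields" "HOL-Algebra.Algebraic_Closure_Type" "HOL-Library.Extended"
begin

text \<open>
  Throughout, the type \<open>'a\<close> plays the role of the compositum of \<open>L\<close> and the algebraic closure
  of \<open>F\<close>; the fields \<open>F\<close>, its algebraic closure \<open>Fb\<close>, and \<open>L\<close> are subsets of \<open>'a\<close>.
  \<^const>\<open>ring_of_type_algebra\<close> turns \<open>'a\<close> into a HOL-Algebra record, which gives access to
  the library's subfields, generated fields, transcendental elements and quotient rings.
\<close>

abbreviation gen_field :: "'a::field set \<Rightarrow> 'a set"
  where "gen_field A \<equiv> generate_field ring_of_type_algebra A"

abbreviation transcendental_over :: "'a::field set \<Rightarrow> 'a \<Rightarrow> bool"
  where "transcendental_over K x \<equiv> (ring.transcendental ring_of_type_algebra over K) x"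

definition derivation :: "('a::field \<Rightarrow> 'a) \<Rightarrow> bool"
  where "derivation D \<longleftrightarrow>
    (\<forall>x y. D (x + y) = D x + D y) \<and> (\<forall>x y. D (x * y) = D x * y + x * D y)"

definition power_free :: "('a, 'b) ring_scheme \<Rightarrow> nat \<Rightarrow> 'a \<Rightarrow> bool"
  where "power_free A m q \<longleftrightarrow>
    (\<forall>p\<in>carrier A. (p [^]\<^bsub>A\<^esub> m) divides\<^bsub>A\<^esub> q \<longrightarrow> p \<in> Units A)"

text \<open>
  The polynomial ring \<open>F[t\<^sub>1,\<dots>,t\<^sub>j]\<close> is realised as the subring generated by \<open>F\<close> and the \<open>t\<^sub>i\<close>,
  which are algebraically independent over \<open>F\<close>. The derivation \<open>D\<close> is the one on the compositum,
  so it is required to vanish on \<open>Fb\<close>.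
\<close>

locale differential_tower =
  fixes F Fb L :: "'a::field_char_0 set"
    and D :: "'a \<Rightarrow> 'a"
    and j m n :: nat
    and t :: "nat \<Rightarrow> 'a"
    and y q :: 'a
  assumes subfield_F: "subfield F ring_of_type_algebra"
    and subfield_Fb: "subfield Fb ring_of_type_algebra"
    and alg_closure_Fb: "algebraic_closure (ring_of_type_algebra\<lparr>carrier := Fb\<rparr>) F"
    and compositum: "gen_field (Fb \<union> L) = UNIV"
    and derivation_D: "derivation D"
    and D_Fb: "\<And>c. c \<in> Fb \<Longrightarrow> D c = 0"
    and j_le_n: "j \<le> n"
    \<comment> \<open>\<open>K\<^sub>0 = F(t\<^sub>1,\<dots>,t\<^sub>j)\<close>\<close>
    and D_F: "D ` F \<subseteq> F"
    and T1_transcendental: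
      "\<And>i. i \<in> {1..j} \<Longrightarrow> transcendental_over (gen_field (F \<union> t ` {1..<i})) (t i)"
    and T1_D: "\<And>i. i \<in> {1..j} \<Longrightarrow> D (t i) \<in> gen_field (F \<union> t ` {1..i})"
    \<comment> \<open>the radical extension \<open>K\<^sub>0(y)\<close>\<close>
    and m_pos: "1 \<le> m"
    and y_power: "y ^ m = q"
    and q_poly: "q \<in> generate_ring ring_of_type_algebra (F \<union> t ` {1..j})"
    and q_power_free:
      "power_free (ring_of_type_algebra
         \<lparr>carrier := generate_ring ring_of_type_algebra (F \<union> t ` {1..j})\<rparr>) m q"
    and irreducible:
      "let R = ring_of_type_algebra; K = gen_field (Fb \<union> t ` {1..j}); P = K[X]\<^bsub>R\<^esub>
       in pirreducible\<^bsub>R\<^esub> K ((X\<^bsub>R\<^esub> [^]\<^bsub>P\<^esub> m) \<ominus>\<^bsub>P\<^esub> ring.poly_of_const R q)"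
    \<comment> \<open>\<open>L = K\<^sub>0(y)(t\<^sub>j\<^sub>+\<^sub>1,\<dots>,t\<^sub>n)\<close>\<close>
    and T3_transcendental:
      "\<And>i. i \<in> {j+1..n} \<Longrightarrow>
         transcendental_over (gen_field (F \<union> t ` {1..j} \<union> {y} \<union> t ` {j+1..<i})) (t i)"
    and T3_D:
      "\<And>i. i \<in> {j+1..n} \<Longrightarrow> D (t i) \<in> gen_field (F \<union> t ` {1..j} \<union> {y} \<union> t ` {j+1..i})"
    and L_eq: "L = gen_field (F \<union> t ` {1..j} \<union> {y} \<union> t ` {j+1..n})"
    and constants_L: "{x \<in> L. D x = 0} = F"


subsection \<open>Elementary integrals\<close>

definition elementary_over :: "('b::field_char_0 \<Rightarrow> 'b) \<Rightarrow> 'b set \<Rightarrow> 'b \<Rightarrow> bool"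
  where "elementary_over \<delta> M \<theta> \<longleftrightarrow>
    \<not> transcendental_over M \<theta> \<or>
    (\<exists>u\<in>M. u \<noteq> 0 \<and> \<delta> \<theta> = \<delta> u / u) \<or>
    (\<theta> \<noteq> 0 \<and> (\<exists>u\<in>M. \<delta> \<theta> / \<theta> = \<delta> u))"

inductive elementary_extension :: "('b::field_char_0 \<Rightarrow> 'b) \<Rightarrow> 'b set \<Rightarrow> 'b set \<Rightarrow> bool"
  for \<delta> K
where
  base: "elementary_extension \<delta> K K"
| adjoin: "\<lbrakk>elementary_extension \<delta> K M; elementary_over \<delta> M \<theta>\<rbrakk> \<Longrightarrow>
             elementary_extension \<delta> K (gen_field (insert \<theta> M))"

text \<open>
  The elementary extension of \<open>L\<close> lives in a differential field of another type \<open>'b\<close>, into which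
  \<open>L\<close> is embedded by \<open>\<iota>\<close>. In a theorem with this predicate as a premise and \<open>'b\<close> a type variable
  occurring nowhere else, the premise says that some such field exists.
\<close>

definition has_elementary_integral ::
  "'b::field_char_0 itself \<Rightarrow> ('a::field_char_0 \<Rightarrow> 'a) \<Rightarrow> 'a set \<Rightarrow> 'a \<Rightarrow> bool"
  where "has_elementary_integral T D L f \<longleftrightarrow>
    (\<exists>(\<iota> :: 'a \<Rightarrow> 'b) \<delta> M h.
       derivation \<delta> \<and>
       \<iota> \<in> ring_hom (ring_of_type_algebra\<lparr>carrier := L\<rparr>) ring_of_type_algebra \<and>
       (\<forall>x\<in>L. \<delta> (\<iota> x) = \<iota> (D x)) \<and>
       elementary_extension \<delta> (\<iota> ` L) M \<and> h \<in> M \<and> \<delta> h = \<iota> f)"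


subsection \<open>Discrete valuations\<close>

text \<open>
  A discrete valuation is an integer-valued function constrained on nonzero arguments only;
  \<open>ext_val v\<close> is its extension by \<open>v(0) = \<infinity>\<close>.
\<close>

definition discrete_valuation :: "('a::field \<Rightarrow> int) \<Rightarrow> bool"
  where "discrete_valuation v \<longleftrightarrow>
    (\<forall>x y. x \<noteq> 0 \<longrightarrow> y \<noteq> 0 \<longrightarrow> v (x * y) = v x + v y) \<and>
    (\<forall>x y. x \<noteq> 0 \<longrightarrow> y \<noteq> 0 \<longrightarrow> x + y \<noteq> 0 \<longrightarrow> min (v x) (v y) \<le> v (x + y)) \<and>
    v ` (UNIV - {0}) = UNIV"

definition ext_val :: "('a::field \<Rightarrow> int) \<Rightarrow> 'a \<Rightarrow> int extended"
  where "ext_val v x = (if x = 0 then \<infinity> else Fin (v x))"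

definition uniformiser :: "('a::field \<Rightarrow> int) \<Rightarrow> 'a \<Rightarrow> bool"
  where "uniformiser v \<pi> \<longleftrightarrow> \<pi> \<noteq> 0 \<and> v \<pi> = 1"

definition valuation_ring :: "('a::field \<Rightarrow> int) \<Rightarrow> 'a ring"
  where "valuation_ring v = ring_of_type_algebra\<lparr>carrier := {x. x = 0 \<or> 0 \<le> v x}\<rparr>"

definition valuation_ideal :: "('a::field \<Rightarrow> int) \<Rightarrow> 'a set"
  where "valuation_ideal v = {x. x = 0 \<or> 0 < v x}"

definition residue_field :: "('a::field \<Rightarrow> int) \<Rightarrow> 'a set ring"
  where "residue_field v = valuation_ring v Quot valuation_ideal v"

definition residue_class :: "('a::field \<Rightarrow> int) \<Rightarrow> 'a \<Rightarrow> 'a set"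
  where "residue_class v x = valuation_ideal v +>\<^bsub>valuation_ring v\<^esub> x"


subsection \<open>Shifts, the residual derivation and kernel degrees\<close>

text \<open>Only meaningful for \<open>D h \<noteq> 0\<close>.\<close>

definition shift :: "('a::field \<Rightarrow> int) \<Rightarrow> ('a \<Rightarrow> 'a) \<Rightarrow> 'a \<Rightarrow> int"
  where "shift v D h = v (D h) - v h"

definition v_bounded :: "('a::field \<Rightarrow> int) \<Rightarrow> ('a \<Rightarrow> 'a) \<Rightarrow> bool"
  where "v_bounded v D \<longleftrightarrow> (\<exists>B. \<forall>h. h \<noteq> 0 \<longrightarrow> D h \<noteq> 0 \<longrightarrow> B \<le> shift v D h)"

definition min_shift :: "('a::field \<Rightarrow> int) \<Rightarrow> ('a \<Rightarrow> 'a) \<Rightarrow> int"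
  where "min_shift v D = (LEAST k. \<exists>h. h \<noteq> 0 \<and> D h \<noteq> 0 \<and> k = shift v D h)"

text \<open>
  The image below is a singleton whenever \<open>D\<close> is \<open>v\<close>-bounded and \<open>C\<close> is a residue class: this is
  the independence of the class of \<open>\<pi>\<^sup>-\<^sup>s D c\<close> of the representative \<open>c\<close>.
\<close>

definition residue_derivation ::
  "('a::field \<Rightarrow> int) \<Rightarrow> ('a \<Rightarrow> 'a) \<Rightarrow> 'a \<Rightarrow> 'a set \<Rightarrow> 'a set"
  where "residue_derivation v D \<pi> C =
    the_elem ((\<lambda>c. residue_class v (\<pi> powi (- min_shift v D) * D c)) ` C)"

text \<open>\<open>residue_rho v D \<pi> 0\<close> is \<open>\<rho>\<^sub>v\<close>, and \<open>residue_rho v D \<pi> r\<close> is \<open>\<rho>\<^sub>v\<^sup>(\<^sup>r\<^sup>)\<close>.\<close>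

definition residue_rho :: "('a::field \<Rightarrow> int) \<Rightarrow> ('a \<Rightarrow> 'a) \<Rightarrow> 'a \<Rightarrow> int \<Rightarrow> 'a set"
  where "residue_rho v D \<pi> r = residue_class v (\<pi> powi (- min_shift v D - 1 - r) * D \<pi>)"

definition kernel_degrees :: "('a::field \<Rightarrow> int) \<Rightarrow> ('a \<Rightarrow> 'a) \<Rightarrow> 'a \<Rightarrow> int set"
  where "kernel_degrees v D \<pi> =
    (let \<kappa> = residue_field v in
     {a. \<exists>C \<in> carrier \<kappa> - {\<zero>\<^bsub>\<kappa>\<^esub>}.
           residue_derivation v D \<pi> C = add_pow \<kappa> (- a) (residue_rho v D \<pi> 0 \<otimes>\<^bsub>\<kappa>\<^esub> C)})"

definition residue_constants :: "('a::field \<Rightarrow> int) \<Rightarrow> ('a \<Rightarrow> 'a) \<Rightarrow> 'a \<Rightarrow> 'a set set"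
  where "residue_constants v D \<pi> =
    {C \<in> carrier (residue_field v). residue_derivation v D \<pi> C = \<zero>\<^bsub>residue_field v\<^esub>}"

end

theory Submission
  imports Defs
begin

text \<open>
  Logarithmic derivatives have valuation at least \<open>s\<close>, and elements of \<open>Fb\<close> have valuation \<open>0\<close>,
  so \<open>v(D g) \<ge> min(v f, s)\<close>. Let \<open>g = \<pi>\<^sup>a w\<close> with \<open>w\<close> a unit, and suppose that \<open>a\<close> is below the
  claimed bound.

  If \<open>r = 0\<close>, the class of \<open>\<pi>\<^sup>-\<^sup>s\<^sup>-\<^sup>a D g\<close> is \<open>\<partial>w + a \<rho> w\<close> and must vanish, which makes \<open>a < 0\<close> a kernel
  degree.

  If \<open>r \<ge> 1\<close>, then \<open>D w\<close> agrees with \<open>- a w \<pi>\<^sup>-\<^sup>1 D \<pi>\<close>, of valuation \<open>s + r\<close>, up to higher order. Since the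
  residue constants are \<open>Fb\<close>, the terms of \<open>w\<close> of order below \<open>r\<close> have coefficients in \<open>Fb\<close>, and
  \<open>D w\<close> agrees with \<open>\<pi>\<^sup>r D e\<close> for an integral \<open>e\<close>. With \<open>c\<close> the class of \<open>w\<close>, this exhibits \<open>\<rho>\<^sup>(\<^sup>r\<^sup>)\<close> as
  \<open>\<partial>\<close> of the class of \<open>- e / (a c)\<close>.
\<close>

section \<open>The filtration of a field by a discrete valuation\<close>

text \<open>\<open>v 0\<close> is an unconstrained integer, so zero is added by hand. The closure
  rules then need no nonvanishing hypotheses, and a congruence modulo a power of
  \<open>\<pi>\<close> becomes membership of a difference.\<close>

definition val_ge :: "('a::field \<Rightarrow> int) \<Rightarrow> int \<Rightarrow> 'a set"
  where "val_ge v k = {x. x = 0 \<or> k \<le> v x}"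

locale valued_field =
  fixes v :: "'a::field \<Rightarrow> int"
  assumes discrete_valuation: "discrete_valuation v"
begin

lemma v_mult: "x \<noteq> 0 \<Longrightarrow> y \<noteq> 0 \<Longrightarrow> v (x * y) = v x + v y"
  using discrete_valuation unfolding discrete_valuation_def by blast

lemma v_add: "x \<noteq> 0 \<Longrightarrow> y \<noteq> 0 \<Longrightarrow> x + y \<noteq> 0 \<Longrightarrow> min (v x) (v y) \<le> v (x + y)"
  using discrete_valuation unfolding discrete_valuation_def by blast

lemma v_one [simp]: "v 1 = 0"
  using v_mult[of 1 1] by simp

lemma v_uminus [simp]: "v (- x) = v x"
proof (cases "x = 0")
  case False
  have "v (- 1) = 0" using v_mult[of "-1" "-1"] by simp
  then show ?thesis using v_mult[of "-1" x] False by simp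
qed simp

lemma v_inverse: "x \<noteq> 0 \<Longrightarrow> v (inverse x) = - v x"
  using v_mult[of x "inverse x"] by simp

lemma v_power: "x \<noteq> 0 \<Longrightarrow> v (x ^ n) = int n * v x"
  by (induction n) (auto simp: v_mult algebra_simps)

lemma v_powi: "x \<noteq> 0 \<Longrightarrow> v (x powi a) = a * v x"
  by (auto simp: power_int_def v_power v_inverse)

lemma val_ge_0 [simp]: "0 \<in> val_ge v k"
  by (simp add: val_ge_def)

lemma one_val_ge [simp]: "1 \<in> val_ge v 0"
  by (simp add: val_ge_def)

lemma val_ge_mono: "x \<in> val_ge v k \<Longrightarrow> l \<le> k \<Longrightarrow> x \<in> val_ge v l"
  by (auto simp: val_ge_def)

lemma val_ge_add: "x \<in> val_ge v k \<Longrightarrow> y \<in> val_ge v k \<Longrightarrow> x + y \<in> val_ge v k"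
  using v_add[of x y] by (fastforce simp: val_ge_def)

lemma val_ge_uminus [simp]: "- x \<in> val_ge v k \<longleftrightarrow> x \<in> val_ge v k"
  by (simp add: val_ge_def)

lemma val_ge_diff: "x \<in> val_ge v k \<Longrightarrow> y \<in> val_ge v k \<Longrightarrow> x - y \<in> val_ge v k"
  using val_ge_add[of x k "- y"] by simp

lemma val_ge_mult: "x \<in> val_ge v k \<Longrightarrow> y \<in> val_ge v l \<Longrightarrow> x * y \<in> val_ge v (k + l)"
  using v_mult[of x y] by (fastforce simp: val_ge_def)

lemma val_ge_sum: "(\<And>i. i \<in> I \<Longrightarrow> h i \<in> val_ge v k) \<Longrightarrow> (\<Sum>i\<in>I. h i) \<in> val_ge v k"
  by (induction I rule: infinite_finite_induct) (auto intro: val_ge_add)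

lemma of_nat_val_ge: "of_nat n \<in> val_ge v 0"
  by (induction n) (auto intro: val_ge_add)

lemma of_int_val_ge: "of_int a \<in> val_ge v 0"
proof (cases "0 \<le> a")
  case True
  then show ?thesis using of_nat_val_ge[of "nat a"] by simp
next
  case False
  then have "of_int a = - (of_nat (nat (- a)) :: 'a)" by simp
  then show ?thesis using of_nat_val_ge[of "nat (- a)"] by (metis val_ge_uminus)
qed

lemma powi_val_ge: "x \<noteq> 0 \<Longrightarrow> v x = 1 \<Longrightarrow> x powi a \<in> val_ge v a"
  by (simp add: val_ge_def v_powi)

lemma mult_powi_val_ge:
  assumes "\<pi> \<noteq> 0" "v \<pi> = 1" "x \<in> val_ge v k" "l \<le> a + k"
  shows "\<pi> powi a * x \<in> val_ge v l"
  by (rule val_ge_mono[OF val_ge_mult[OF powi_val_ge[OF assms(1,2)] assms(3)] assms(4)])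

section \<open>Residue classes and the residue field\<close>

lemma valuation_ideal_eq: "valuation_ideal v = val_ge v 1"
  by (auto simp: valuation_ideal_def val_ge_def)

lemma residue_class_altdef: "residue_class v x = (\<lambda>z. z + x) ` val_ge v 1"
  by (auto simp: residue_class_def a_r_coset_def r_coset_def valuation_ring_def
      ring_of_type_algebra_def valuation_ideal_eq)

lemma residue_class_eq_iff: "residue_class v x = residue_class v y \<longleftrightarrow> x - y \<in> val_ge v 1"
proof
  assume "residue_class v x = residue_class v y"
  moreover have "x \<in> residue_class v x"
    unfolding residue_class_altdef by (rule image_eqI[of _ _ 0]) simp_all
  ultimately show "x - y \<in> val_ge v 1" by (auto simp: residue_class_altdef)
next
  assume xy: "x - y \<in> val_ge v 1"
  have "z + x \<in> (\<lambda>z. z + y) ` val_ge v 1" if "z \<in> val_ge v 1" for z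
    using val_ge_add[OF that xy] by (intro image_eqI[of _ _ "z + (x - y)"]) simp_all
  moreover have "z + y \<in> (\<lambda>z. z + x) ` val_ge v 1" if "z \<in> val_ge v 1" for z
    using val_ge_diff[OF that xy] by (intro image_eqI[of _ _ "z - (x - y)"]) simp_all
  ultimately show "residue_class v x = residue_class v y" by (auto simp: residue_class_altdef)
qed

lemma valuation_ring_simps:
  "carrier (valuation_ring v) = val_ge v 0"
  "x \<otimes>\<^bsub>valuation_ring v\<^esub> y = x * y"
  "x \<oplus>\<^bsub>valuation_ring v\<^esub> y = x + y"
  "\<one>\<^bsub>valuation_ring v\<^esub> = 1"
  "\<zero>\<^bsub>valuation_ring v\<^esub> = 0"
  by (auto simp: valuation_ring_def ring_of_type_algebra_def val_ge_def)

lemma val_ge_0_mult: "x \<in> val_ge v 0 \<Longrightarrow> y \<in> val_ge v 0 \<Longrightarrow> x * y \<in> val_ge v 0"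
  using val_ge_mult[of x 0 y 0] by simp

lemma ring_valuation_ring: "ring (valuation_ring v)"
proof (rule ringI)
  show "abelian_group (valuation_ring v)"
    by (rule abelian_groupI)
      (auto simp: valuation_ring_simps algebra_simps intro: val_ge_add bexI[of _ "- x" for x])
  show "monoid (valuation_ring v)"
    by (rule monoidI) (auto simp: valuation_ring_simps algebra_simps intro: val_ge_0_mult)
qed (auto simp: valuation_ring_simps algebra_simps)

lemma uminus_valuation_ring: "x \<in> val_ge v 0 \<Longrightarrow> \<ominus>\<^bsub>valuation_ring v\<^esub> x = - x"
  by (rule abelian_group.minus_equality[OF ring.is_abelian_group[OF ring_valuation_ring]])
    (simp_all add: valuation_ring_simps)

lemma ideal_valuation_ideal: "ideal (valuation_ideal v) (valuation_ring v)"
proof (rule idealI[OF ring_valuation_ring])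
  show "subgroup (valuation_ideal v) (add_monoid (valuation_ring v))"
  proof (rule subgroup.intro)
    show "inv\<^bsub>add_monoid (valuation_ring v)\<^esub> x \<in> valuation_ideal v"
      if "x \<in> valuation_ideal v" for x
      using that uminus_valuation_ring[of x] val_ge_mono[of x 1 0]
      unfolding a_inv_def valuation_ideal_eq by simp
  qed (auto simp: valuation_ring_simps valuation_ideal_eq val_ge_add elim: val_ge_mono)
  show "x \<otimes>\<^bsub>valuation_ring v\<^esub> a \<in> valuation_ideal v" "a \<otimes>\<^bsub>valuation_ring v\<^esub> x \<in> valuation_ideal v"
    if "a \<in> valuation_ideal v" "x \<in> carrier (valuation_ring v)" for a x
    using that val_ge_mult[of x 0 a 1] by (simp_all add: valuation_ring_simps valuation_ideal_eq mult.commute)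
qed

lemma carrier_residue_field: "carrier (residue_field v) = residue_class v ` val_ge v 0"
  by (auto simp: residue_field_def FactRing_def A_RCOSETS_def' residue_class_def valuation_ring_simps)

lemma zero_residue_field: "\<zero>\<^bsub>residue_field v\<^esub> = residue_class v 0"
  by (simp add: residue_field_def FactRing_def residue_class_altdef valuation_ideal_eq)

lemma mult_residue_field:
  assumes "x \<in> val_ge v 0" "y \<in> val_ge v 0"
  shows "residue_class v x \<otimes>\<^bsub>residue_field v\<^esub> residue_class v y = residue_class v (x * y)"
  using ideal.rcoset_mult_add[OF ideal_valuation_ideal, of x y] assms
  by (simp add: residue_field_def FactRing_def residue_class_def valuation_ring_simps)

text \<open>The integer multiple in \<open>kernel_degrees\<close> is a power in an additive monoid.
  It is computed in the valuation ring and carried over by the residue homomorphism.\<close>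

lemma add_pow_residue_field:
  assumes x: "x \<in> val_ge v 0"
  shows "add_pow (residue_field v) (a::int) (residue_class v x) = residue_class v (of_int a * x)"
proof -
  have nat: "add_pow (valuation_ring v) n x = of_nat n * x" for n :: nat
    by (induction n) (simp_all add: add_pow_def nat_pow_0 nat_pow_Suc valuation_ring_simps algebra_simps)
  have int: "add_pow (valuation_ring v) a x = of_int a * x"
  proof (cases "0 \<le> a")
    case True
    then show ?thesis by (simp add: add_pow_int_ge nat)
  next
    case False
    moreover have "of_nat (nat (- a)) * x \<in> val_ge v 0"
      by (intro val_ge_0_mult of_nat_val_ge x)
    ultimately show ?thesis by (simp add: add_pow_int_lt nat uminus_valuation_ring)
  qed
  interpret ring_hom_ring "valuation_ring v" "residue_field v" "residue_class v"
    using ideal.rcos_ring_hom_ring[OF ideal_valuation_ideal]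
    unfolding residue_field_def residue_class_def .
  have "residue_class v (x [^]\<^bsub>add_monoid (valuation_ring v)\<^esub> a)
      = residue_class v x [^]\<^bsub>add_monoid (residue_field v)\<^esub> a"
    by (rule group_hom.hom_int_pow[OF a_group_hom]) (simp add: x valuation_ring_simps)
  then show ?thesis using int by (simp add: add_pow_def)
qed

section \<open>Algebraically closed subfields under a valuation\<close>

text \<open>
  An algebraically closed subfield is divisible, so a valuation with values in \<open>\<int>\<close> is trivial on it;
  square roots suffice for this.
\<close>

lemma algebraically_closed_val_0:
  assumes C: "algebraically_closed (ring_of_type_algebra\<lparr>carrier := C\<rparr>)"
    and c: "c \<in> C" "c \<noteq> 0"
  shows "v c = 0"
proof -
  define R where "R = (ring_of_type_algebra\<lparr>carrier := C\<rparr> :: 'a ring)"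
  interpret algebraically_closed R using C unfolding R_def .
  have R: "carrier R = C" "\<And>x y. x \<otimes>\<^bsub>R\<^esub> y = x * y" "\<And>x y. x \<oplus>\<^bsub>R\<^esub> y = x + y"
    "\<one>\<^bsub>R\<^esub> = 1" "\<zero>\<^bsub>R\<^esub> = 0"
    by (auto simp: R_def ring_of_type_algebra_def)
  have sqrt: "\<exists>b\<in>C. b * b = c" if "c \<in> C" for c
  proof -
    \<comment> \<open>The polynomial X^2 - c, leading coefficient first. It splits, so its multiset
      of roots is nonempty.\<close>
    define P where "P = [\<one>\<^bsub>R\<^esub>, \<zero>\<^bsub>R\<^esub>, \<ominus>\<^bsub>R\<^esub> c]"
    have P: "P \<in> carrier (poly_ring R)"
      using that one_closed zero_closed a_inv_closed[of c] one_not_zero R(1)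
      by (simp add: P_def univ_poly_def polynomial_def)
    then have "roots P \<noteq> {#}"
      using roots_over_carrier[OF P] by (auto simp: splitted_def P_def)
    then obtain b where "is_root P b" using roots_mem_iff_is_root[OF P] by blast
    then have b: "b \<in> carrier R" and "b \<otimes>\<^bsub>R\<^esub> b \<oplus>\<^bsub>R\<^esub> \<ominus>\<^bsub>R\<^esub> c = \<zero>\<^bsub>R\<^esub>"
      using that R(1) by (auto simp: is_root_def P_def numeral_2_eq_2)
    then have "b \<otimes>\<^bsub>R\<^esub> b = c" using that R(1) by (metis m_closed minus_eq r_right_minus_eq)
    then show ?thesis using b R by auto
  qed
  \<comment> \<open>Descent on the absolute value of \<open>v c\<close>: a square root
    \<open>b\<close> halves it, so if \<open>v c\<close> were nonzero, the induction hypothesis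
    would give \<open>v b = 0\<close> and hence \<open>v c = 0\<close>.\<close>
  show ?thesis using c
  proof (induction "nat \<bar>v c\<bar>" arbitrary: c rule: less_induct)
    case less
    obtain b where b: "b \<in> C" "b * b = c" using sqrt less.prems(1) by blast
    then have "b \<noteq> 0" using less.prems(2) by auto
    then have "v c = 2 * v b" using v_mult[of b b] b(2) by simp
    then show ?case using less.hyps[of b] b \<open>b \<noteq> 0\<close> by fastforce
  qed
qed

text \<open>Together with the triviality of the valuation this gives nonzero integers valuation
  zero, which later justifies dividing by the order of \<open>g\<close> when \<open>r\<close> is at
  least 1.\<close>

lemma algebraically_closed_of_int:
  fixes C :: "'a set"
  assumes C: "algebraically_closed (ring_of_type_algebra\<lparr>carrier := C\<rparr>)"
  shows "of_int a \<in> C"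
proof -
  define R where "R = (ring_of_type_algebra\<lparr>carrier := C\<rparr> :: 'a ring)"
  interpret algebraically_closed R using C unfolding R_def .
  have R: "carrier R = C" "\<And>x y. x \<oplus>\<^bsub>R\<^esub> y = x + y" "\<one>\<^bsub>R\<^esub> = 1" "\<zero>\<^bsub>R\<^esub> = 0"
    by (auto simp: R_def ring_of_type_algebra_def)
  have nat: "of_nat n \<in> C" for n
  proof (induction n)
    case (Suc n)
    then show ?case using a_closed[of 1 "of_nat n"] one_closed by (simp add: R)
  qed (use zero_closed in \<open>simp add: R\<close>)
  have "- x \<in> C" if "x \<in> C" for x
  proof -
    have "\<ominus>\<^bsub>R\<^esub> x + x = 0" using l_neg[of x] that by (simp add: R)
    then have "\<ominus>\<^bsub>R\<^esub> x = - x" by (simp add: eq_neg_iff_add_eq_0)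
    then show ?thesis using a_inv_closed[of x] that by (simp add: R)
  qed
  then show ?thesis using nat[of "nat a"] nat[of "nat (- a)"] by (cases "0 \<le> a") force+
qed

end

section \<open>Derivations of a field\<close>

locale derivation_field =
  fixes D :: "'a::field \<Rightarrow> 'a"
  assumes derivation_D: "derivation D"
begin

lemma D_add: "D (x + y) = D x + D y"
  using derivation_D unfolding derivation_def by blast

lemma D_mult: "D (x * y) = D x * y + x * D y"
  using derivation_D unfolding derivation_def by blast

lemma D_0 [simp]: "D 0 = 0"
  by (metis D_add add_0 add_cancel_right_right)

lemma D_1 [simp]: "D 1 = 0"
  by (metis D_mult mult_1 mult_1_right add_cancel_right_right)

lemma D_uminus: "D (- x) = - D x"
  using D_add[of x "- x"] by (simp add: eq_neg_iff_add_eq_0 add.commute)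

lemma D_diff: "D (x - y) = D x - D y"
  using D_add[of x "- y"] by (simp add: D_uminus)

lemma D_powi:
  assumes "x \<noteq> 0"
  shows "D (x powi a) = of_int a * x powi (a - 1) * D x"
proof (induction a rule: int_induct[where k = 0])
  case base
  show ?case by simp
next
  case (step1 i)
  have "D (x powi (i + 1)) = D (x powi i) * x + x powi i * D x"
    using assms by (simp add: power_int_add_1 D_mult)
  also have "\<dots> = of_int i * (x powi (i - 1) * x) * D x + x powi i * D x"
    using step1 by simp
  also have "x powi (i - 1) * x = x powi i"
    using assms power_int_add_1[of x "i - 1"] by simp
  finally show ?case by (simp add: algebra_simps)
next
  \<comment> \<open>The downward step takes the product rule for x^i = x^(i-1) x and solves it for
    the derivative of x^(i-1).\<close>
  case (step2 i)
  have eq: "x powi (i - 1) = x powi (i - 2) * x"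
    using assms power_int_add_1[of x "i - 2"] by simp
  have "D (x powi i) = D (x powi (i - 1)) * x + x powi (i - 1) * D x"
    using assms power_int_add_1[of x "i - 1"] D_mult by simp
  then have "D (x powi (i - 1)) * x = (of_int i - 1) * x powi (i - 1) * D x"
    using step2 by (simp add: algebra_simps)
  also have "\<dots> = of_int (i - 1) * x powi (i - 2) * D x * x"
    unfolding eq by simp
  finally show ?case using assms by simp
qed

end

section \<open>Pole bounds for a derivation bounded along the valuation\<close>

text \<open>Stated as a shift of the filtration, boundedness also covers elements with
  \<open>D x = 0\<close>. The constant \<open>s\<close> is tied to \<open>min_shift\<close> only
  later, so the two pole bounds take their residue field hypotheses as congruences between
  representatives.\<close>

locale bounded_derivation = valued_field v + derivation_field D
  for v :: "'a::field_char_0 \<Rightarrow> int" and D +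
  fixes \<pi> :: 'a and s :: int
  assumes pi_nonzero [simp]: "\<pi> \<noteq> 0" and v_pi: "v \<pi> = 1"
    and D_val_ge: "x \<in> val_ge v k \<Longrightarrow> D x \<in> val_ge v (k + s)"
begin

lemmas pi_powi_mult = mult_powi_val_ge[OF pi_nonzero v_pi]

lemma unit_part:
  assumes "x \<noteq> 0"
  shows "\<pi> powi (- v x) * x \<noteq> 0" "v (\<pi> powi (- v x) * x) = 0"
  using assms v_pi by (auto simp: v_mult v_powi)

text \<open>With \<open>k = s + r\<close> this improves on \<open>D_val_ge\<close> by
  \<open>r\<close>, so for positive \<open>r\<close> powers of \<open>\<pi>\<close> behave like
  constants to leading order.\<close>

lemma D_powi_val_ge:
  assumes "D \<pi> \<in> val_ge v (k + 1)"
  shows "D (\<pi> powi a) \<in> val_ge v (a + k)"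
proof -
  have "of_int a * (\<pi> powi (a - 1) * D \<pi>) \<in> val_ge v (0 + (a + k))"
    by (intro val_ge_mult of_int_val_ge pi_powi_mult[OF assms]) simp
  then show ?thesis by (simp add: D_powi mult.assoc)
qed

lemma log_derivative_val_ge:
  assumes "x \<noteq> 0"
  shows "D x / x \<in> val_ge v s"
proof -
  have "D x \<in> val_ge v (v x + s)" by (rule D_val_ge) (simp add: val_ge_def)
  moreover have "inverse x \<in> val_ge v (- v x)"
    using assms by (simp add: val_ge_def v_inverse)
  ultimately have "D x * inverse x \<in> val_ge v (v x + s + - v x)" by (rule val_ge_mult)
  then show ?thesis by (simp add: divide_inverse)
qed

text \<open>\<open>nondeg\<close> forbids cancellation in the coefficient of D(\<pi>^a w) at order s
  + a. If a = v g were below \<open>k\<close>, then \<open>D g\<close> would have order at most s +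
  a, which is less than k + s; \<open>k \<le> 0\<close> makes a negative.\<close>

lemma pole_bound_nondegenerate:
  assumes nondeg: "\<And>a w. \<lbrakk>a < 0; w \<noteq> 0; v w = 0\<rbrakk> \<Longrightarrow>
      \<pi> powi (- s) * D w + of_int a * (\<pi> powi (- s - 1) * D \<pi> * w) \<notin> val_ge v 1"
    and Dg: "D g \<in> val_ge v (k + s)" and "k \<le> 0"
  shows "g \<in> val_ge v k"
proof (rule ccontr)
  assume "g \<notin> val_ge v k"
  then have g: "g \<noteq> 0" and less: "v g < k" by (auto simp: val_ge_def)
  define a w where "a = v g" and "w = \<pi> powi (- a) * g"
  have w: "w \<noteq> 0" "v w = 0" using unit_part[OF g] by (auto simp: a_def w_def)
  have g_eq: "g = \<pi> powi a * w" by (simp add: w_def power_int_minus)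
  have "\<pi> powi (- s - a) * D g
      = \<pi> powi (- s) * D w + of_int a * (\<pi> powi (- s - 1) * D \<pi> * w)"
    unfolding g_eq D_mult D_powi[OF pi_nonzero]
    by (simp add: power_int_diff power_int_minus field_simps)
  moreover have "\<pi> powi (- s - a) * D g \<in> val_ge v 1"
    by (rule pi_powi_mult[OF Dg]) (use less in \<open>simp add: a_def\<close>)
  ultimately show False using nondeg[of a w] w less \<open>k \<le> 0\<close> by (simp add: a_def)
qed

text \<open>
  Peeling off the leading coefficients one at a time: each of them is a residue constant,
  and the derivative of \<open>c \<pi>\<^sup>i\<close> with \<open>c\<close> constant and \<open>i > 0\<close> has valuation above \<open>s + r\<close>.
\<close>

lemma constant_expansion:
  assumes Dpi: "D \<pi> \<in> val_ge v (s + int r + 1)"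
    and C: "\<And>c. c \<in> C \<Longrightarrow> D c = 0" "C \<subseteq> val_ge v 0"
    and residue: "\<And>w. \<lbrakk>w \<in> val_ge v 0; D w \<in> val_ge v (s + 1)\<rbrakk> \<Longrightarrow> \<exists>c\<in>C. w - c \<in> val_ge v 1"
    and w: "w \<in> val_ge v 0" "D w \<in> val_ge v (s + int r)"
    and "k \<le> r"
  shows "\<exists>z \<in> val_ge v (int k). D w - D z \<in> val_ge v (s + int r + 1)"
  using \<open>k \<le> r\<close>
proof (induction k)
  case 0
  show ?case by (rule bexI[of _ w]) (use w in auto)
next
  case (Suc k)
  then obtain z where z: "z \<in> val_ge v (int k)" and Dz: "D w - D z \<in> val_ge v (s + int r + 1)"
    by auto
  have "D w - (D w - D z) \<in> val_ge v (s + int r)"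
    by (rule val_ge_diff[OF w(2) val_ge_mono[OF Dz]]) simp
  then have Dz': "D z \<in> val_ge v (s + int r)" by simp
  \<comment> \<open>The leading coefficient of \<open>z\<close>. Both terms of \<open>D y\<close>
    have order at least s + r - k, which exceeds s because k < r, so the class of \<open>y\<close>
    is a residue constant.\<close>
  define y where "y = \<pi> powi (- int k) * z"
  have z_eq: "z = \<pi> powi (int k) * y" by (simp add: y_def power_int_minus)
  have y: "y \<in> val_ge v 0" unfolding y_def by (rule pi_powi_mult[OF z]) simp
  have "D (\<pi> powi (- int k)) * z \<in> val_ge v (- int k + (s + int r) + int k)"
    by (intro val_ge_mult D_powi_val_ge Dpi z)
  then have "D (\<pi> powi (- int k)) * z \<in> val_ge v (s + 1)"
    by (rule val_ge_mono) (use Suc.prems in simp)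
  moreover have "\<pi> powi (- int k) * D z \<in> val_ge v (s + 1)"
    by (rule pi_powi_mult[OF Dz']) (use Suc.prems in simp)
  ultimately have "D y \<in> val_ge v (s + 1)" unfolding y_def D_mult by (rule val_ge_add)
  then obtain c where c: "c \<in> C" "y - c \<in> val_ge v 1" using residue y by blast
  \<comment> \<open>This is \<open>z\<close> with its leading term c \<pi>^k removed.\<close>
  define z' where "z' = \<pi> powi (int k) * (y - c)"
  have z': "z' \<in> val_ge v (int (Suc k))" unfolding z'_def by (rule pi_powi_mult[OF c(2)]) simp
  have "D z - D z' = c * D (\<pi> powi (int k))"
    using C(1)[OF c(1)] by (simp add: z_eq z'_def D_mult D_diff algebra_simps)
  \<comment> \<open>For k = 0 the removed term is the constant \<open>c\<close> itself, with
    derivative zero; for positive k the factor \<pi>^k lifts the order above s + r.\<close>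
  moreover have "c * D (\<pi> powi (int k)) \<in> val_ge v (s + int r + 1)"
  proof (cases "k = 0")
    case False
    have "c * D (\<pi> powi (int k)) \<in> val_ge v (0 + (int k + (s + int r)))"
      using c(1) C(2) by (intro val_ge_mult D_powi_val_ge Dpi) auto
    then show ?thesis by (rule val_ge_mono) (use False in simp)
  qed simp
  ultimately have "(D w - D z) + (D z - D z') \<in> val_ge v (s + int r + 1)"
    using Dz by (intro val_ge_add) simp_all
  then show ?case using z' by (intro bexI[of _ z']) simp_all
qed

text \<open>\<open>C\<close> consists of constants of \<open>D\<close> lifting the residue
  constants; \<open>residue\<close> and \<open>not_exact\<close> express condition (ii) on
  representatives. The conditions on \<open>C\<close> make - a c, for nonzero a and c, a unit that
  \<open>D\<close> treats as a constant.\<close>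

lemma pole_bound_degenerate:
  assumes r: "1 \<le> r" and Dpi: "D \<pi> \<in> val_ge v (s + r + 1)"
    and C: "\<And>c. c \<in> C \<Longrightarrow> D c = 0" "\<And>c. \<lbrakk>c \<in> C; c \<noteq> 0\<rbrakk> \<Longrightarrow> v c = 0" "\<And>a. of_int a \<in> C"
    and residue: "\<And>w. \<lbrakk>w \<in> val_ge v 0; D w \<in> val_ge v (s + 1)\<rbrakk> \<Longrightarrow> \<exists>c\<in>C. w - c \<in> val_ge v 1"
    and not_exact: "\<And>e. e \<in> val_ge v 0 \<Longrightarrow>
      \<pi> powi (- s - 1 - r) * D \<pi> - \<pi> powi (- s) * D e \<notin> val_ge v 1"
    and Dg: "D g \<in> val_ge v (k + s)" and "k \<le> 0"
  shows "g \<in> val_ge v (k - r)"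
proof (rule ccontr)
  assume "g \<notin> val_ge v (k - r)"
  then have g: "g \<noteq> 0" and less: "v g < k - r" by (auto simp: val_ge_def)
  define a w where "a = v g" and "w = \<pi> powi (- a) * g"
  have w: "w \<noteq> 0" "v w = 0" using unit_part[OF g] by (auto simp: a_def w_def)
  have w0: "w \<in> val_ge v 0" using w by (simp add: val_ge_def)
  have "a \<noteq> 0" using less r \<open>k \<le> 0\<close> by (simp add: a_def)
  define \<tau> where "\<tau> = \<pi> powi (- 1) * D \<pi>"
  have \<tau>: "\<tau> \<in> val_ge v (s + r)" unfolding \<tau>_def by (rule pi_powi_mult[OF Dpi]) simp
  \<comment> \<open>The strict inequality v g < k - r supplies the extra 1, so this term is
    negligible at order s + r.\<close>
  have Dg': "\<pi> powi (- a) * D g \<in> val_ge v (s + r + 1)"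
    by (rule pi_powi_mult[OF Dg]) (use less in \<open>simp add: a_def\<close>)
  have Dw: "D w = \<pi> powi (- a) * D g - of_int a * (\<tau> * w)"
    unfolding w_def D_mult D_powi[OF pi_nonzero] \<tau>_def
    by (simp add: power_int_diff power_int_minus field_simps)
  have "of_int a * (\<tau> * w) \<in> val_ge v (0 + (s + r + 0))"
    by (intro val_ge_mult of_int_val_ge \<tau> w0)
  then have Dw_ge: "D w \<in> val_ge v (s + r)"
    unfolding Dw using Dg' by (intro val_ge_diff) (auto elim: val_ge_mono)
  have "D w \<in> val_ge v (s + 1)" using Dw_ge r by (auto elim: val_ge_mono)
  then obtain c where c: "c \<in> C" "w - c \<in> val_ge v 1" using residue w0 by blast
  have "c \<noteq> 0" using c(2) w by (auto simp: val_ge_def)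
  \<comment> \<open>The expansion is taken to full depth: \<open>z\<close> is divisible by \<pi>^r
    and yet has the derivative of \<open>w\<close> modulo order s + r + 1.\<close>
  have "\<exists>z \<in> val_ge v (int (nat r)). D w - D z \<in> val_ge v (s + int (nat r) + 1)"
  proof (rule constant_expansion[where C = C])
    show "C \<subseteq> val_ge v 0" using C(2) by (force simp: val_ge_def)
  qed (use r Dpi C(1) residue w0 Dw_ge in \<open>auto simp: algebra_simps\<close>)
  then obtain z where z: "z \<in> val_ge v r" and Dz: "D w - D z \<in> val_ge v (s + r + 1)"
    using r by auto
  \<comment> \<open>Modulo order s + r + 1, \<open>D w\<close> is - a \<tau> w, and there
    \<open>w\<close> may be replaced by \<open>c\<close>. So \<open>D z\<close> agrees with
    \<open>b * \<tau>\<close>, and the constant unit \<open>b\<close> can be divided out.\<close>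
  define b where "b = - of_int a * c"
  have b: "b \<noteq> 0" "v b = 0" "D b = 0"
    using \<open>a \<noteq> 0\<close> \<open>c \<noteq> 0\<close> C(1,2)[OF C(3)[of a]] C(1,2)[OF c(1)]
    by (auto simp: b_def v_mult D_mult D_uminus)
  have inv_b: "inverse b \<in> val_ge v 0" using b by (simp add: val_ge_def v_inverse)
  have D_inv_b: "D (inverse b) = 0" using D_mult[of b "inverse b"] b by simp
  \<comment> \<open>The integral element contradicting \<open>not_exact\<close>; the factor 1/b is
    already included.\<close>
  define e where "e = inverse b * (\<pi> powi (- r) * z)"
  have "inverse b * (\<pi> powi (- r) * z) \<in> val_ge v (0 + 0)"
    by (intro val_ge_mult inv_b pi_powi_mult[OF z]) simp
  then have e: "e \<in> val_ge v 0" by (simp add: e_def)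
  have "of_int a * (\<tau> * (w - c)) \<in> val_ge v (0 + (s + r + 1))"
    by (intro val_ge_mult of_int_val_ge \<tau> c(2))
  then have "(D w - D z) - \<pi> powi (- a) * D g + of_int a * (\<tau> * (w - c)) \<in> val_ge v (s + r + 1)"
    by (intro val_ge_add[OF val_ge_diff[OF Dz Dg']]) simp
  also have "(D w - D z) - \<pi> powi (- a) * D g + of_int a * (\<tau> * (w - c)) = b * \<tau> - D z"
    unfolding Dw b_def by (simp add: algebra_simps)
  finally have "b * \<tau> - D z \<in> val_ge v (s + r + 1)" .
  then have "\<pi> powi (- s - r) * (b * \<tau> - D z) \<in> val_ge v 1"
    by (rule pi_powi_mult) simp
  \<comment> \<open>The extra product rule term caused by dividing \<open>z\<close> by \<pi>^r. Its
    order is at least s + r, above s.\<close>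
  moreover have "D (\<pi> powi (- r)) * z \<in> val_ge v (- r + (s + r) + r)"
    by (intro val_ge_mult D_powi_val_ge Dpi z)
  then have "\<pi> powi (- s) * (D (\<pi> powi (- r)) * z) \<in> val_ge v 1"
    by (rule pi_powi_mult) (use r in simp)
  ultimately have "\<pi> powi (- s - r) * (b * \<tau> - D z) - \<pi> powi (- s) * (D (\<pi> powi (- r)) * z)
      \<in> val_ge v 1"
    by (rule val_ge_diff)
  then have "inverse b * (\<pi> powi (- s - r) * (b * \<tau> - D z)
      - \<pi> powi (- s) * (D (\<pi> powi (- r)) * z)) \<in> val_ge v (0 + 1)"
    by (rule val_ge_mult[OF inv_b])
  also have "inverse b * (\<pi> powi (- s - r) * (b * \<tau> - D z)
      - \<pi> powi (- s) * (D (\<pi> powi (- r)) * z)) = \<pi> powi (- s - 1 - r) * D \<pi> - \<pi> powi (- s) * D e"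
    unfolding e_def D_mult D_inv_b \<tau>_def using b(1)
    by (simp add: power_int_add power_int_diff power_int_minus field_simps)
  finally show False using not_exact[OF e] by simp
qed

section \<open>The residual derivation and the kernel degrees\<close>

context
  assumes s_eq: "s = min_shift v D"
begin

text \<open>Representatives differ by some \<open>z\<close> of order at least 1, and
  \<open>D z\<close> then has order at least s + 1, so its scaled class vanishes. Hence
  \<open>the_elem\<close> is applied to a singleton.\<close>

lemma residue_derivation_class:
  assumes "w \<in> val_ge v 0"
  shows "residue_derivation v D \<pi> (residue_class v w) = residue_class v (\<pi> powi (- s) * D w)"
proof -
  have "residue_class v (\<pi> powi (- s) * D (z + w)) = residue_class v (\<pi> powi (- s) * D w)"
    if "z \<in> val_ge v 1" for z
  proof -
    have "\<pi> powi (- s) * D z \<in> val_ge v 1"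
      by (rule pi_powi_mult[OF D_val_ge[OF that]]) simp
    then show ?thesis by (simp add: residue_class_eq_iff D_add algebra_simps)
  qed
  then have "(\<lambda>c. residue_class v (\<pi> powi (- s) * D c)) ` residue_class v w
      = {residue_class v (\<pi> powi (- s) * D w)}"
    unfolding residue_class_altdef[of w] image_image by (auto intro!: image_eqI[of _ _ 0])
  then show ?thesis by (simp add: residue_derivation_def flip: s_eq)
qed

text \<open>The expression in \<open>kernel\<close> represents the residual derivative of w plus a
  \<rho> w. \<open>Dpi\<close> makes the representative of \<rho> integral, so the product and the
  multiple can be computed on representatives.\<close>

lemma kernel_degreesI:
  assumes Dpi: "D \<pi> \<in> val_ge v (s + 1)" and w: "w \<noteq> 0" "v w = 0"
    and kernel: "\<pi> powi (- s) * D w + of_int a * (\<pi> powi (- s - 1) * D \<pi> * w) \<in> val_ge v 1"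
  shows "a \<in> kernel_degrees v D \<pi>"
proof -
  have w0: "w \<in> val_ge v 0" and w1: "w \<notin> val_ge v 1" using w by (auto simp: val_ge_def)
  have rho: "\<pi> powi (- s - 1) * D \<pi> \<in> val_ge v 0" by (rule pi_powi_mult[OF Dpi]) simp
  have "add_pow (residue_field v) (- a) (residue_rho v D \<pi> 0 \<otimes>\<^bsub>residue_field v\<^esub> residue_class v w)
      = residue_class v (of_int (- a) * (\<pi> powi (- s - 1) * D \<pi> * w))"
    unfolding residue_rho_def s_eq[symmetric]
    using mult_residue_field[OF rho w0] add_pow_residue_field[OF val_ge_0_mult[OF rho w0]] by simp
  also have "\<dots> = residue_derivation v D \<pi> (residue_class v w)"
    unfolding residue_derivation_class[OF w0] residue_class_eq_iff
    using kernel by (subst val_ge_uminus[symmetric]) (simp add: algebra_simps)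
  finally show ?thesis using w0 w1
    by (auto simp: kernel_degrees_def Let_def carrier_residue_field zero_residue_field
        residue_class_eq_iff intro!: exI[of _ "residue_class v w"])
qed

lemma residue_constantsI:
  assumes "w \<in> val_ge v 0" "D w \<in> val_ge v (s + 1)"
  shows "residue_class v w \<in> residue_constants v D \<pi>"
proof -
  have "\<pi> powi (- s) * D w \<in> val_ge v 1" by (rule pi_powi_mult[OF assms(2)]) simp
  then show ?thesis
    using assms(1) by (auto simp: residue_constants_def carrier_residue_field zero_residue_field
        residue_derivation_class residue_class_eq_iff)
qed

end

end

section \<open>Attainment of the minimal shift and the bound for \<open>g\<close>\<close>

text \<open>The integers are not well ordered, so the minimum behind \<open>LEAST\<close> is found
  among natural numbers offset by the lower bound \<open>B\<close>.\<close>

lemma min_shift_le: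
  assumes "v_bounded v D" "h \<noteq> 0" "D h \<noteq> 0"
  shows "min_shift v D \<le> shift v D h"
proof -
  define S where "S = {k. \<exists>h. h \<noteq> 0 \<and> D h \<noteq> 0 \<and> k = shift v D h}"
  obtain B where B: "\<forall>k\<in>S. B \<le> k" using assms(1) unfolding v_bounded_def S_def by blast
  have h: "shift v D h \<in> S" using assms(2,3) unfolding S_def by blast
  define n where "n = (LEAST n. B + int n \<in> S)"
  have "B + int (nat (shift v D h - B)) \<in> S" using h B by auto
  then have n: "B + int n \<in> S" unfolding n_def by (rule LeastI)
  have n_le: "B + int n \<le> k" if "k \<in> S" for k
  proof -
    have "B + int (nat (k - B)) \<in> S" using that B by auto
    then have "n \<le> nat (k - B)" unfolding n_def by (rule Least_le)
    then show ?thesis using B that by fastforce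
  qed
  have "min_shift v D = B + int n"
    unfolding min_shift_def by (rule Least_equality) (use n n_le in \<open>auto simp: S_def\<close>)
  then show ?thesis using n_le[OF h] by simp
qed


theorem theorem8p7:
  fixes F Fb L :: "'a::field_char_0 set"
    and D :: "'a \<Rightarrow> 'a"
    and j m n :: nat
    and t :: "nat \<Rightarrow> 'a"
    and y q :: 'a
    and v :: "'a \<Rightarrow> int"
    and \<pi> f g :: 'a
    and s r :: int
    and N :: nat
    and c u :: "nat \<Rightarrow> 'a"
  assumes tower: "differential_tower F Fb L D j m n t y q"
    and valuation: "discrete_valuation v"
    and uniformiser: "uniformiser v \<pi>"
    and bounded: "v_bounded v D"
    and s: "s = min_shift v D"
    and r: "r = shift v D \<pi> - s"
    and f: "f \<in> L"
    and elementary: "has_elementary_integral TYPE('b::field_char_0) D L f"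
    and c: "\<And>i. i < N \<Longrightarrow> c i \<in> Fb"
    and u: "\<And>i. i < N \<Longrightarrow> u i \<noteq> 0"
    and f_eq: "f = D g + (\<Sum>i<N. c i * (D (u i) / u i))"
    and cases:
      "r = 0 \<and> kernel_degrees v D \<pi> \<inter> {..<0} = {} \<or>
       r \<ge> 1 \<and> residue_constants v D \<pi> = residue_class v ` Fb \<and>
         (\<forall>C \<in> carrier (residue_field v). residue_rho v D \<pi> r \<noteq> residue_derivation v D \<pi> C)"
  shows "ext_val v g \<ge> min 0 (ext_val v f - Fin s) - Fin r \<and>
         min 0 (ext_val v f - Fin s) - Fin r = min (Fin (- r)) (ext_val v f - Fin (shift v D \<pi>))"
proof -
  interpret T: differential_tower F Fb L D j m n t y q by (rule tower)
  interpret A: algebraic_closure "ring_of_type_algebra\<lparr>carrier := Fb\<rparr>" F by (rule T.alg_closure_Fb)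
  interpret valued_field v by unfold_locales (rule valuation)
  interpret derivation_field D by unfold_locales (rule T.derivation_D)
  have pi: "\<pi> \<noteq> 0" "v \<pi> = 1" using uniformiser by (auto simp: uniformiser_def)
  interpret bounded_derivation v D \<pi> s
  proof
    show "D x \<in> val_ge v (k + s)" if x: "x \<in> val_ge v k" for x k
    proof (cases "D x = 0")
      case False
      then have "x \<noteq> 0" by auto
      then show ?thesis
        using min_shift_le[where v = v and D = D, OF bounded \<open>x \<noteq> 0\<close> False] x False s
        by (auto simp: val_ge_def shift_def)
    qed simp
  qed (fact pi)+
  have v_Fb: "v c = 0" if "c \<in> Fb" "c \<noteq> 0" for c
    by (rule algebraically_closed_val_0[OF A.algebraically_closed_axioms that])
  have Fb_0: "c \<in> val_ge v 0" if "c \<in> Fb" for c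
    using v_Fb[OF that] by (cases "c = 0") (simp_all add: val_ge_def)
  \<comment> \<open>The definition of \<open>r\<close> rewritten with \<open>v \<pi> = 1\<close>; if
    \<open>D \<pi> = 0\<close> the membership is trivial.\<close>
  have Dpi: "D \<pi> \<in> val_ge v (s + r + 1)"
    using r pi by (simp add: val_ge_def shift_def)
  \<comment> \<open>The integer value of min(0, v(f) - s). For \<open>f = 0\<close> the extended
    valuation is infinite, so the minimum is 0 whatever \<open>v f\<close> is.\<close>
  define k where "k = (if f = 0 then 0 else min 0 (v f - s))"
  have k: "k \<le> 0" "f \<in> val_ge v (k + s)" by (auto simp: k_def val_ge_def)
  have "(\<Sum>i<N. c i * (D (u i) / u i)) \<in> val_ge v (0 + s)"
    using c u by (intro val_ge_sum val_ge_mult Fb_0 log_derivative_val_ge) auto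
  then have "(\<Sum>i<N. c i * (D (u i) / u i)) \<in> val_ge v (k + s)"
    by (rule val_ge_mono) (use k in simp)
  then have "f - (\<Sum>i<N. c i * (D (u i) / u i)) \<in> val_ge v (k + s)"
    by (rule val_ge_diff[OF k(2)])
  then have Dg: "D g \<in> val_ge v (k + s)" using f_eq by simp
  from cases have "g \<in> val_ge v (k - r)"
  proof (elim disjE conjE)
    assume r0: "r = 0" and degrees: "kernel_degrees v D \<pi> \<inter> {..<0} = {}"
    have "g \<in> val_ge v k"
    proof (rule pole_bound_nondegenerate[OF _ Dg k(1)])
      show "\<pi> powi (- s) * D w + of_int a * (\<pi> powi (- s - 1) * D \<pi> * w) \<notin> val_ge v 1"
        if "a < 0" "w \<noteq> 0" "v w = 0" for a w
        using kernel_degreesI[OF s, of w a] that degrees Dpi r0 by auto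
    qed
    then show ?thesis using r0 by simp
  next
    assume r1: "r \<ge> 1" and const: "residue_constants v D \<pi> = residue_class v ` Fb"
      and rho: "\<forall>C \<in> carrier (residue_field v). residue_rho v D \<pi> r \<noteq> residue_derivation v D \<pi> C"
    show ?thesis
    proof (rule pole_bound_degenerate[where C = Fb, OF r1 Dpi T.D_Fb v_Fb _ _ _ Dg k(1)])
      show "of_int a \<in> Fb" for a
        by (rule algebraically_closed_of_int[OF A.algebraically_closed_axioms])
      show "\<exists>c\<in>Fb. w - c \<in> val_ge v 1" if "w \<in> val_ge v 0" "D w \<in> val_ge v (s + 1)" for w
        using residue_constantsI[OF s that] const by (auto simp: residue_class_eq_iff)
      show "\<pi> powi (- s - 1 - r) * D \<pi> - \<pi> powi (- s) * D e \<notin> val_ge v 1"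
        if "e \<in> val_ge v 0" for e
        using rho that
        by (simp add: carrier_residue_field residue_rho_def residue_derivation_class[OF s]
            residue_class_eq_iff flip: s)
    qed
  qed
  \<comment> \<open>The second conjunct subtracts \<open>r\<close> inside the minimum, since the
    shift of \<open>\<pi>\<close> is s + r.\<close>
  then show ?thesis using r
    by (auto simp: ext_val_def val_ge_def k_def zero_extended_def)
qed

end
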